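(* Let $m\ge1$ be an integer, $t_1,\dots,t_m\in\mathbb{R}$ with $t_m>0$, and $\lambda>-1$. For $n\ge1$, the monic orthogonal polynomials $P_n(x)=P_n(x;T_m;\lambda)$ with respect to $w(x;T_m;\lambda)=|x|^{2\lambda+1}\exp(-\sum_{k=1}^m t_kx^{2k})$ satisfy the second-order differential equation (at $x\ne0$ with $A_n(x)\neq 0$) $$P_n''(x)-\Bigl(V'(x)+\frac{A_n'(x)}{A_n(x)}\Bigr)P_n'(x)+\Bigl(B_n'(x)-B_n^2(x)-V'(x)B_n(x)+\beta_nA_n(x)A_{n-1}(x)-\frac{A_n'(x)B_n(x)}{A_n(x)}\Bigr)P_n(x)=0,$$ where $$V(x)=\sum_{k=1}^m t_kx^{2k}-(2\lambda+1)\ln|x|,$$ $$A_n(x)=\sum_{k=2}^m\sum_{i=1}^{k-1}2kt_k(F_{i,n}+F_{i,n+1})x^{2(k-1-i)}+\sum_{k=1}^m2kt_kx^{2k-2},$$ $$B_n(x)=\sum_{k=2}^m\sum_{i=1}^{k-1}2kt_kF_{i,n}x^{2(k-i-1)+1}+\frac{2\lambda+1}{2x}\bigl(1-(-1)^n\bigr).$$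
   Context: Let $T_m=(t_1,\dots,t_m)$. $P_n(x;T_m;\lambda)$ is the monic polynomial of degree $n$ in the sequence orthogonal with respect to $w(x;T_m;\lambda)\,dx$ on $\mathbb{R}$; since $w$ is even, $xP_n=P_{n+1}+\beta_nP_{n-1}$ with $P_0=1$, $P_{-1}=0$, $\beta_0=0$. Convention: $\beta_j=0$ for $j\le0$; empty sums are zero. The quantities $F_{k,n}$ are defined by $F_{1,n}=\beta_n$ and, for $k=2,\dots,m$, $$F_{k,n}=F_{1,n}(F_{k-1,n-1}+2F_{k-1,n}+F_{k-1,n+1})+F_{1,n}\sum_{\substack{i+j=k-1\\1\le i,j\le k-2}}(F_{i,n}+F_{i,n+1})(F_{j,n-1}+F_{j,n})-\sum_{\substack{i+j=k\\1\le i,j\le k-1}}F_{i,n}F_{j,n}.$$ *)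

theory Defs
  imports "HOL-Analysis.Analysis" "HOL-Computational_Algebra.Polynomial"
begin

(* A time sequence is a function t :: nat => real of which only the values t 1, ..., t m are used. *)

definition weight :: "nat \<Rightarrow> (nat \<Rightarrow> real) \<Rightarrow> real \<Rightarrow> real \<Rightarrow> real" where
  "weight m t lam x = \<bar>x\<bar> powr (2 * lam + 1) * exp (- (\<Sum>k = 1..m. t k * x ^ (2 * k)))"

(* has_bochner_integral demands integrability as well, so orthogonality is never due to the
   convention that divergent integrals are 0. *)
definition monic_orthogonal_polys :: "(real \<Rightarrow> real) \<Rightarrow> (nat \<Rightarrow> real poly) \<Rightarrow> bool" where
  "monic_orthogonal_polys w P \<longleftrightarrow>
     (\<forall>n. degree (P n) = n \<and> lead_coeff (P n) = 1) \<and>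
     (\<forall>i j. i \<noteq> j \<longrightarrow>
        has_bochner_integral lborel (\<lambda>x. poly (P i) x * poly (P j) x * w x) 0)"

(* For an even weight, x P_n = P_(n+1) + b P_(n-1) with a unique b when n >= 1.
   The index is an integer because Fcoef beta k n below refers to n - 1 even for n = 0. *)
definition rec_coeff :: "(nat \<Rightarrow> real poly) \<Rightarrow> int \<Rightarrow> real" where
  "rec_coeff P n =
     (if n \<le> 0 then 0
      else THE b. [:0, 1:] * P (nat n) = P (nat n + 1) + smult b (P (nat n - 1)))"

(* The pairs with i + j = s and 1 <= i, j <= s - 1 are enumerated by i = 1, ..., s - 1
   with j = s - i. Index k = 0 is not meaningful. *)
function Fcoef :: "(int \<Rightarrow> real) \<Rightarrow> nat \<Rightarrow> int \<Rightarrow> real" where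
  "Fcoef \<beta> k n =
     (if k = 0 then 0
      else if k = 1 then \<beta> n
      else \<beta> n * (Fcoef \<beta> (k - 1) (n - 1) + 2 * Fcoef \<beta> (k - 1) n + Fcoef \<beta> (k - 1) (n + 1))
         + \<beta> n * (\<Sum>i = 1..k - 2. (Fcoef \<beta> i n + Fcoef \<beta> i (n + 1)) *
                                 (Fcoef \<beta> (k - 1 - i) (n - 1) + Fcoef \<beta> (k - 1 - i) n))
         - (\<Sum>i = 1..k - 1. Fcoef \<beta> i n * Fcoef \<beta> (k - i) n))"
  by pat_completeness auto
termination by (relation "Wellfounded.measure (\<lambda>(\<beta>, k, n). k)") auto

(* The defining equation is unconditional, so it would make the simplifier loop. *)
declare Fcoef.simps [simp del]

definition Vpot :: "nat \<Rightarrow> (nat \<Rightarrow> real) \<Rightarrow> real \<Rightarrow> real \<Rightarrow> real" where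
  "Vpot m t lam x = (\<Sum>k = 1..m. t k * x ^ (2 * k)) - (2 * lam + 1) * ln \<bar>x\<bar>"

definition Acoef :: "nat \<Rightarrow> (nat \<Rightarrow> real) \<Rightarrow> (int \<Rightarrow> real) \<Rightarrow> nat \<Rightarrow> real \<Rightarrow> real" where
  "Acoef m t \<beta> n x =
     (\<Sum>k = 2..m. \<Sum>i = 1..k - 1.
        2 * real k * t k * (Fcoef \<beta> i (int n) + Fcoef \<beta> i (int n + 1)) * x ^ (2 * (k - 1 - i)))
     + (\<Sum>k = 1..m. 2 * real k * t k * x ^ (2 * k - 2))"

definition Bcoef :: "nat \<Rightarrow> (nat \<Rightarrow> real) \<Rightarrow> real \<Rightarrow> (int \<Rightarrow> real) \<Rightarrow> nat \<Rightarrow> real \<Rightarrow> real" where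
  "Bcoef m t lam \<beta> n x =
     (\<Sum>k = 2..m. \<Sum>i = 1..k - 1.
        2 * real k * t k * Fcoef \<beta> i (int n) * x ^ (2 * (k - i - 1) + 1))
     + (2 * lam + 1) / (2 * x) * (1 - (- 1) ^ n)"

end

theory Submission
  imports Defs
begin

text \<open>
  Write \<open>L p = \<integral> p w\<close>, and let \<open>d\<^sub>j(n)\<close> and \<open>c\<^sub>j(n)\<close> (\<open>diag j n\<close> and \<open>subdiag j n\<close> below) be the coefficients of \<open>P\<^sub>n\<close> and \<open>P\<^sub>n\<^sub>-\<^sub>1\<close>
  in the expansion of \<open>x\<^sup>j P\<^sub>n\<close>. The part of \<open>x\<^sup>j P\<^sub>n\<close> in the span of \<open>P\<^sub>0, \<dots>, P\<^sub>n\<^sub>-\<^sub>1\<close> is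
  \<open>\<Sum>l<j. x\<^sup>j\<^sup>-\<^sup>1\<^sup>-\<^sup>l (\<beta>\<^sub>n d\<^sub>l(n) P\<^sub>n\<^sub>-\<^sub>1 - c\<^sub>l(n) P\<^sub>n)\<close>. Its own \<open>P\<^sub>n\<^sub>-\<^sub>1\<close>-coefficient is again \<open>c\<^sub>j(n)\<close>, which
  yields a convolution identity; for \<open>j = 2 k - 1\<close> this is exactly the recursion defining \<open>F\<^sub>k\<^sub>,\<^sub>n\<close>,
  so \<open>F\<^sub>k\<^sub>,\<^sub>n = c\<^sub>2\<^sub>k\<^sub>-\<^sub>1(n)\<close>. Integration by parts in the form
  \<open>L (x p' + (2 \<lambda> + 2) p) = L ((\<Sum>k. 2 k t\<^sub>k x\<^sup>2\<^sup>k) p)\<close>, which avoids the possibly non-integrable \<open>w / x\<close>,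
  shows that \<open>x P\<^sub>n' - n P\<^sub>n\<close> is the lower part of \<open>(\<Sum>k. 2 k t\<^sub>k x\<^sup>2\<^sup>k) P\<^sub>n\<close>. This is the lowering relation
  \<open>P\<^sub>n' = - B\<^sub>n P\<^sub>n + \<beta>\<^sub>n A\<^sub>n P\<^sub>n\<^sub>-\<^sub>1\<close>; with \<open>B\<^sub>n + B\<^sub>n\<^sub>+\<^sub>1 = x A\<^sub>n - V'\<close> it gives the raising relation, and
  eliminating \<open>P\<^sub>n\<^sub>-\<^sub>1\<close> gives the differential equation.
\<close>

section \<open>Degree bounds and auxiliary identities\<close>

text \<open>Unlike \<open>degree p < n\<close>, this admits \<open>p = 0\<close> when \<open>n = 0\<close>.\<close>

definition low :: "nat \<Rightarrow> real poly \<Rightarrow> bool" where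
  "low n p \<longleftrightarrow> (\<forall>k\<ge>n. coeff p k = 0)"

lemma low_0_iff [simp]: "low 0 p \<longleftrightarrow> p = 0"
  by (auto simp: low_def poly_eq_iff)

lemma low_zero [simp]: "low n 0"
  by (simp add: low_def)

lemma low_add: "low n p \<Longrightarrow> low n q \<Longrightarrow> low n (p + q)"
  by (simp add: low_def)

lemma low_diff: "low n p \<Longrightarrow> low n q \<Longrightarrow> low n (p - q)"
  by (simp add: low_def)

lemma low_smult: "low n p \<Longrightarrow> low n (smult a p)"
  by (simp add: low_def)

lemma low_sum: "(\<And>i. i \<in> A \<Longrightarrow> low n (f i)) \<Longrightarrow> low n (sum f A)"
  by (simp add: low_def coeff_sum)

lemma low_mono: "low m p \<Longrightarrow> m \<le> n \<Longrightarrow> low n p"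
  by (simp add: low_def)

lemma low_degree: "degree p < n \<Longrightarrow> low n p"
  by (simp add: low_def coeff_eq_0)

lemma low_mult_x: "low n p \<Longrightarrow> low (Suc n) ([:0, 1:] * p)"
  by (auto simp: low_def coeff_pCons split: nat.splits)

lemma low_x_pderiv: "low n p \<Longrightarrow> low n ([:0, 1:] * pderiv p)"
  by (auto simp: low_def coeff_pCons coeff_pderiv split: nat.splits)

text \<open>Separates even from odd indices. The odd ones are written \<open>2 * i - 1\<close> with
  \<open>i\<close> starting at 1, which matches the index range of the F quantities.\<close>

lemma sum_double_split:
  "(\<Sum>l<2 * k. g l) = (\<Sum>i<k. g (2 * i)) + (\<Sum>i = 1..k. g (2 * i - 1))"
  for g :: "nat \<Rightarrow> 'a::comm_monoid_add"
  by (induction k) (auto simp: algebra_simps)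

lemma monom_mult_x: "[:0, 1:] * monom 1 j = monom (1::real) (Suc j)"
  by (metis mult.left_neutral monom_Suc mult_pCons_left smult_0_left add_0 one_poly_def pCons_one)

subsection \<open>Orthogonal polynomials of a symmetric functional\<close>

text \<open>An abstract functional on polynomials keeps the algebra free of integrability questions;
  \<open>L_reflect\<close> stands for the evenness of the weight.\<close>

locale symmetric_orthogonal_polys =
  fixes L :: "real poly \<Rightarrow> real" and P :: "nat \<Rightarrow> real poly"
  assumes L_add: "L (p + q) = L p + L q"
    and L_smult: "L (smult a p) = a * L p"
    and degree_P: "degree (P n) = n"
    and monic_P: "coeff (P n) n = 1"
    and orth: "i \<noteq> j \<Longrightarrow> L (P i * P j) = 0"
    and norm_pos: "L (P n * P n) > 0"
    and L_reflect: "L (pcompose p [:0, -1:]) = L p"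
begin

lemma L_0 [simp]: "L 0 = 0"
  using L_smult[of 0 0] by simp

lemma L_minus: "L (- p) = - L p"
  using L_smult[of "-1" p] by simp

lemma L_diff: "L (p - q) = L p - L q"
  using L_add[of p "- q"] by (simp add: L_minus)

lemma L_sum: "L (sum f A) = (\<Sum>i\<in>A. L (f i))"
  by (induction A rule: infinite_finite_induct) (auto simp: L_add)

lemmas L_linear = L_add L_diff L_smult L_minus L_sum

definition h :: "nat \<Rightarrow> real" where "h n = L (P n * P n)"

lemma h_pos: "h n > 0"
  using norm_pos by (simp add: h_def)

lemma h_neq_0 [simp]: "h n \<noteq> 0"
  using h_pos[of n] by simp

lemma low_P: "low (Suc n) (P n)"
  by (simp add: low_degree degree_P)

text \<open>\<open>P n\<close> is monic of degree \<open>n\<close>, so the subtraction cancels the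
  top coefficient. This is the descent step of the arguments by degree.\<close>

lemma low_remainder: "low (Suc n) q \<Longrightarrow> low n (q - smult (coeff q n) (P n))"
  using low_P[of n] monic_P[of n]
  by (auto simp: low_def Suc_le_eq) (metis le_neq_implies_less mult.right_neutral mult_zero_right)

lemma orth_low: 
  assumes "low n q" shows "L (P n * q) = 0"
proof -
  \<comment> \<open>The bound \<open>m\<close> on \<open>q\<close> varies while \<open>P n\<close>
    stays fixed; each step removes a multiple of some \<open>P m\<close> with
    \<open>m < n\<close>.\<close>
  have "m \<le> n \<Longrightarrow> low m q \<Longrightarrow> L (P n * q) = 0" for m q
  proof (induction m arbitrary: q)
    case (Suc m)
    let ?r = "q - smult (coeff q m) (P m)"
    have "L (P n * ?r) = 0"
      using Suc by (intro Suc.IH low_remainder) auto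
    moreover have "L (P n * P m) = 0"
      using Suc.prems by (intro orth) auto
    ultimately show ?case
      by (simp add: algebra_simps L_linear)
  qed auto
  thus ?thesis using assms by blast
qed

lemma L_P_mult:
  assumes "low (Suc n) q" shows "L (P n * q) = coeff q n * h n"
  using orth_low[OF low_remainder[OF assms]] by (simp add: algebra_simps L_linear h_def)

text \<open>Testing against \<open>P (degree r)\<close> returns the leading coefficient times a
  positive norm. Polynomial identities are proved below by applying this to the difference of the
  two sides.\<close>

lemma eq_0_if_orth:
  assumes "low n r" and "\<And>q. low n q \<Longrightarrow> L (r * q) = 0"
  shows "r = 0"
proof (rule ccontr)
  assume "r \<noteq> 0"
  have *: "degree r < n"
    using assms(1) \<open>r \<noteq> 0\<close> by (metis low_def leading_coeff_0_iff not_le)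
  have "L (P (degree r) * r) = lead_coeff r * h (degree r)"
    by (intro L_P_mult low_degree) auto
  moreover have "L (r * P (degree r)) = 0"
    using * by (intro assms(2) low_degree) (simp add: degree_P)
  ultimately show False
    using \<open>r \<noteq> 0\<close> by (simp add: mult.commute)
qed

lemma L_odd:
  assumes "pcompose p [:0, -1:] = - p" shows "L p = 0"
  using L_reflect[of p] assms by (simp add: L_minus)

text \<open>Reflection preserves \<open>L\<close> and degree bounds, so the reflected polynomial is
  again orthogonal to everything of lower degree; its leading coefficient is the sign.\<close>

lemma P_reflect: "pcompose (P n) [:0, -1:] = smult ((-1) ^ n) (P n)"
proof -
  let ?r = "pcompose (P n) [:0, -1:] - smult ((-1) ^ n) (P n)"
  have "?r = 0"
  proof (rule eq_0_if_orth)
    show "low n ?r"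
      using low_P[of n] monic_P[of n]
      by (auto simp: low_def coeff_pcompose_linear Suc_le_eq nat_less_le)
  next
    fix q assume q: "low n q"
    have "L (pcompose (P n) [:0, -1:] * q) = L (pcompose (pcompose (P n) [:0, -1:] * q) [:0, -1:])"
      by (simp only: L_reflect)
    also have "pcompose (pcompose (P n) [:0, -1:] * q) [:0, -1:] = P n * pcompose q [:0, -1:]"
      by (simp add: pcompose_mult flip: pcompose_assoc) (simp add: pcompose_pCons)
    also have "L \<dots> = 0"
      using q by (intro orth_low) (auto simp: low_def coeff_pcompose_linear)
    finally show "L (?r * q) = 0"
      using orth_low[OF q] by (simp add: algebra_simps L_linear)
  qed
  thus ?thesis by simp
qed

text \<open>The ratio of consecutive squared norms. The value 0 at \<open>n = 0\<close> makes the
  truncated index in \<open>P (n - 1)\<close> harmless there.\<close>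

definition bet :: "nat \<Rightarrow> real" where
  "bet n = (if n = 0 then 0 else h n / h (n - 1))"

lemma bet_h: "n \<ge> 1 \<Longrightarrow> bet n * h (n - 1) = h n"
  by (simp add: bet_def)

text \<open>The integrand is odd; hence the three-term recurrence has no \<open>P n\<close>
  term.\<close>

lemma L_x_P_P: "L ([:0, 1:] * P n * P n) = 0"
  by (rule L_odd) (simp add: pcompose_mult P_reflect pcompose_pCons flip: power_add mult_2)

lemma recurrence: "[:0, 1:] * P n = P (Suc n) + smult (bet n) (P (n - 1))"
proof -
  let ?r = "[:0, 1:] * P n - P (Suc n) - smult (bet n) (P (n - 1))"
  have "?r = 0"
  proof (rule eq_0_if_orth)
    show "low (Suc n) ?r"
    proof (rule low_diff[OF _ low_smult])
      have "low (Suc n) ([:0, 1:] * P n - smult (coeff ([:0, 1:] * P n) (Suc n)) (P (Suc n)))"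
        by (intro low_remainder low_mult_x low_P)
      moreover have "coeff ([:0, 1:] * P n) (Suc n) = 1"
        using monic_P by simp
      ultimately show "low (Suc n) ([:0, 1:] * P n - P (Suc n))" by simp
      show "low (Suc n) (P (n - 1))"
        by (rule low_mono[OF low_P]) auto
    qed
  next
    fix q assume q: "low (Suc n) q"
    \<comment> \<open>The test polynomial is split into a part of degree below \<open>n\<close>,
      handled by orthogonality, and a multiple of \<open>P n\<close>, handled by parity.\<close>
    define s where "s = q - smult (coeff q n) (P n)"
    have s: "low n s" using low_remainder[OF q] by (simp add: s_def)
    have q_eq: "q = s + smult (coeff q n) (P n)" by (simp add: s_def)
    have "L (P n * ([:0, 1:] * s)) = L (smult (bet n) (P (n - 1)) * s)"
    proof (cases n)
      case 0 thus ?thesis using s by simp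
    next
      case (Suc n')
      \<comment> \<open>The factor x is moved onto \<open>s\<close>, which shifts the top
        coefficient of \<open>s\<close> to position \<open>n\<close>.\<close>
      have "L (P n * ([:0, 1:] * s)) = coeff s n' * h n"
        using low_mult_x[OF s] Suc by (subst L_P_mult) auto
      moreover have "L (P n' * s) = coeff s n' * h n'"
        using s Suc by (intro L_P_mult) auto
      ultimately show ?thesis using Suc by (simp add: L_linear bet_def)
    qed
    hence 1: "L (([:0, 1:] * P n - smult (bet n) (P (n - 1))) * s) = 0"
      by (simp add: algebra_simps L_linear)
    have 2: "L (smult (bet n) (P (n - 1)) * P n) = 0"
      by (cases n) (auto simp: bet_def orth L_linear)
    define X :: "real poly" where "X = [:0, 1:]"
    have "(X * P n - P (Suc n) - smult (bet n) (P (n - 1))) * (s + smult (coeff q n) (P n)) =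
        (X * P n - smult (bet n) (P (n - 1))) * s
        + smult (coeff q n) (X * P n * P n - smult (bet n) (P (n - 1)) * P n)
        - P (Suc n) * (s + smult (coeff q n) (P n))"
      by (simp add: algebra_simps smult_add_right smult_diff_right)
    hence "L (?r * q) = L (([:0, 1:] * P n - smult (bet n) (P (n - 1))) * s)
        + coeff q n * (L ([:0, 1:] * P n * P n) - L (smult (bet n) (P (n - 1)) * P n)) - L (P (Suc n) * q)"
      unfolding q_eq[symmetric] X_def by (simp only: L_linear)
    also have "L (P (Suc n) * q) = 0" using q by (rule orth_low)
    finally show "L (?r * q) = 0" by (simp only: 1 2 L_x_P_P) simp
  qed
  thus ?thesis by (simp add: algebra_simps)
qed

section \<open>Expansion coefficients of x^j P_n and its lower part\<close>

definition diag :: "nat \<Rightarrow> nat \<Rightarrow> real" where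
  "diag j n = L (monom 1 j * P n * P n) / h n"

text \<open>The value 0 at \<open>n = 0\<close> replaces the missing P_(-1), in accordance with
  \<open>bet 0 = 0\<close>.\<close>

definition subdiag :: "nat \<Rightarrow> nat \<Rightarrow> real" where
  "subdiag j n = (if n = 0 then 0 else L (monom 1 j * P n * P (n - 1)) / h (n - 1))"

lemma monom_reflect: "pcompose (monom 1 j) [:0, -1:] = smult ((-1) ^ j) (monom (1::real) j)"
  by (rule poly_eqI) (auto simp: coeff_pcompose_linear)

lemma diag_odd: "odd j \<Longrightarrow> diag j n = 0"
  unfolding diag_def
  by (subst L_odd) (auto simp: pcompose_mult P_reflect monom_reflect simp flip: power_add mult_2)

lemma subdiag_even: "even j \<Longrightarrow> subdiag j n = 0"
proof (cases n)
  case (Suc n')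
  assume "even j"
  have "L (monom 1 j * P n * P n') = 0"
    using \<open>even j\<close> Suc
    by (intro L_odd) (simp add: pcompose_mult P_reflect monom_reflect flip: power_add mult_2)
  thus ?thesis using Suc by (simp add: subdiag_def)
qed (simp add: subdiag_def)

lemma diag_0: "diag 0 n = 1"
  by (simp add: diag_def flip: h_def)

text \<open>One factor x is applied to the second \<open>P n\<close> by the recurrence; its two
  terms give the two subdiagonal coefficients, because \<open>bet n\<close> converts
  \<open>h n\<close> to \<open>h (n - 1)\<close>.\<close>

lemma diag_eq: "diag (Suc j) n = subdiag j n + subdiag j (Suc n)"
proof -
  have "monom 1 (Suc j) * P n * P n = monom 1 j * P n * ([:0, 1:] * P n)"
    by (simp add: monom_mult_x[symmetric] algebra_simps)
  also have "\<dots> = monom 1 j * P (Suc n) * P n + smult (bet n) (monom 1 j * P n * P (n - 1))"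
    unfolding recurrence by (simp add: algebra_simps)
  finally show ?thesis
    by (simp add: diag_def subdiag_def L_linear bet_def field_simps)
qed

text \<open>Unrolled form of the recursion \<open>T_Suc\<close>. Having only
  \<open>P (n - 1)\<close> and \<open>P n\<close> with polynomial factors is what later produces
  \<open>Acoef\<close> and \<open>Bcoef\<close>.\<close>

definition T :: "nat \<Rightarrow> nat \<Rightarrow> real poly" where
  "T n j = (\<Sum>l<j. monom 1 (j - 1 - l) * (smult (bet n * diag l n) (P (n - 1)) - smult (subdiag l n) (P n)))"

lemma T_0 [simp]: "T n 0 = 0"
  by (simp add: T_def)

text \<open>Multiplication by x lifts the \<open>P (n - 1)\<close> component to \<open>P n\<close>,
  where \<open>subdiag j n\<close> has to be removed, and brings the component
  \<open>diag j n\<close> of \<open>P n\<close> down to \<open>P (n - 1)\<close> with factor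
  \<open>bet n\<close>.\<close>

lemma T_Suc: "T n (Suc j) = [:0, 1:] * T n j + smult (bet n * diag j n) (P (n - 1)) - smult (subdiag j n) (P n)"
proof -
  have "[:0, 1:] * T n j = (\<Sum>l<j. monom 1 (j - l) * (smult (bet n * diag l n) (P (n - 1)) - smult (subdiag l n) (P n)))"
    unfolding T_def sum_distrib_left mult.assoc[symmetric]
    by (intro sum.cong) (auto simp: monom_mult_x Suc_diff_Suc simp del: mult_pCons_left)
  thus ?thesis by (simp add: T_def)
qed

text \<open>Both properties are proved in one induction: orthogonality identifies the top
  coefficient of \<open>T n j\<close> as \<open>subdiag j n\<close>, and this is exactly what keeps
  \<open>T n (Suc j)\<close> low.\<close>

lemma T_lower_part:
  assumes "n \<ge> 1"
  shows "low n (T n j)" and "low n q \<Longrightarrow> L ((monom 1 j * P n - T n j) * q) = 0"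
proof -
  have "low n (T n j) \<and> (\<forall>q. low n q \<longrightarrow> L ((monom 1 j * P n - T n j) * q) = 0)"
  proof (induction j)
    case 0
    thus ?case using orth_low by simp
  next
    case (Suc j)
    hence low: "low n (T n j)" and
      eq: "\<And>q. low n q \<Longrightarrow> L (monom 1 j * P n * q) = L (T n j * q)"
      by (auto simp: algebra_simps L_linear)
    have low_pred: "low n (P (n - 1))"
      using low_P[of "n - 1"] assms by simp
    have subdiag_eq: "subdiag j n = coeff (T n j) (n - 1)"
    proof -
      have "L (monom 1 j * P n * P (n - 1)) = L (P (n - 1) * T n j)"
        using eq[OF low_pred] by (simp add: mult.commute)
      also have "\<dots> = coeff (T n j) (n - 1) * h (n - 1)"
        using low assms by (intro L_P_mult) simp
      finally show ?thesis using assms by (simp add: subdiag_def)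
    qed
    have "low n (([:0, 1:] * T n j - smult (coeff ([:0, 1:] * T n j) n) (P n)) + smult (bet n * diag j n) (P (n - 1)))"
      by (intro low_add low_remainder low_smult low_mult_x low low_pred)
    moreover have "coeff ([:0, 1:] * T n j) n = subdiag j n"
      using assms subdiag_eq by (cases n) simp_all
    ultimately have "low n (T n (Suc j))"
      by (simp add: T_Suc algebra_simps)
    moreover have "L ((monom 1 (Suc j) * P n - T n (Suc j)) * q) = 0" if q: "low n q" for q
    proof -
      define a where "a = coeff q (n - 1)"
      \<comment> \<open>The extra factor x is moved onto \<open>q\<close>; the product leaves the
        low range only by a multiple of \<open>P n\<close>, with factor the top coefficient
        \<open>a\<close> of \<open>q\<close>.\<close>
      define s where "s = [:0, 1:] * q - smult a (P n)"
      have "low n ([:0, 1:] * q - smult (coeff ([:0, 1:] * q) n) (P n))"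
        by (intro low_remainder low_mult_x q)
      hence s: "low n s"
        using assms by (cases n) (auto simp: s_def a_def)
      have xq: "[:0, 1:] * q = s + smult a (P n)" by (simp add: s_def)
      have "(monom 1 (Suc j) * P n - T n (Suc j)) * q =
          (monom 1 j * P n - T n j) * ([:0, 1:] * q) - smult (bet n * diag j n) (P (n - 1) * q)
            + smult (subdiag j n) (P n * q)"
        unfolding T_Suc monom_mult_x[symmetric] by (simp add: algebra_simps)
      also have "L \<dots> =
          L (monom 1 j * P n * s) - L (T n j * s) + a * (L (monom 1 j * P n * P n) - L (P n * T n j))
          - bet n * diag j n * L (P (n - 1) * q) + subdiag j n * L (P n * q)"
        unfolding xq by (simp add: algebra_simps L_linear)
      also have "L (P n * T n j) = 0" using low by (rule orth_low)
      also have "L (P n * q) = 0" using q by (rule orth_low)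
      also have "L (P (n - 1) * q) = a * h (n - 1)"
        unfolding a_def using q assms by (intro L_P_mult) auto
      also have "L (monom 1 j * P n * P n) = diag j n * h n" by (simp add: diag_def)
      \<comment> \<open>This makes the two terms containing \<open>diag j n\<close> cancel.\<close>
      also have "h n = bet n * h (n - 1)" using bet_h[OF assms] by simp
      finally show ?thesis using eq[OF s] by simp
    qed
    ultimately show ?case by blast
  qed
  thus "low n (T n j)" and "low n q \<Longrightarrow> L ((monom 1 j * P n - T n j) * q) = 0" by auto
qed

text \<open>\<open>P (n - 1)\<close> is itself low, so x^j P_n may be replaced by
  \<open>T n j\<close> when paired with it; the summands of \<open>T\<close> then pair to further
  \<open>diag\<close> and \<open>subdiag\<close> values.\<close>

lemma subdiag_convolution:
  assumes "n \<ge> 1"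
  shows "subdiag j n = bet n * (\<Sum>l<j. diag l n * diag (j - 1 - l) (n - 1)) - (\<Sum>l<j. subdiag l n * subdiag (j - 1 - l) n)"
proof -
  have "low n (P (n - 1))"
    using low_P[of "n - 1"] assms by simp
  hence "L (monom 1 j * P n * P (n - 1)) = L (T n j * P (n - 1))"
    using T_lower_part(2)[OF assms, of "P (n - 1)" j] by (simp add: algebra_simps L_linear)
  hence "subdiag j n = L (T n j * P (n - 1)) / h (n - 1)"
    using assms by (simp add: subdiag_def)
  also have "T n j * P (n - 1) = (\<Sum>l<j. smult (bet n * diag l n) (monom 1 (j - 1 - l) * P (n - 1) * P (n - 1))
      - smult (subdiag l n) (monom 1 (j - 1 - l) * P n * P (n - 1)))"
    by (simp add: T_def sum_distrib_left algebra_simps)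
  also have "L \<dots> / h (n - 1) = (\<Sum>l<j. bet n * diag l n * diag (j - 1 - l) (n - 1) - subdiag l n * subdiag (j - 1 - l) n)"
    using assms by (simp add: L_linear subdiag_def diag_def sum_divide_distrib diff_divide_distrib)
  finally show ?thesis
    by (simp add: sum_subtractf sum_distrib_left mult.assoc)
qed

end

section \<open>Identification of the quantities F\<close>

context symmetric_orthogonal_polys
begin

text \<open>Closed form of \<open>Fcoef\<close>, see \<open>Fcoef_eq\<close>. Only odd exponents
  occur because the even ones vanish by parity.\<close>

definition F :: "nat \<Rightarrow> nat \<Rightarrow> real" where "F k n = subdiag (2 * k - 1) n"

lemma F_0_right [simp]: "F k 0 = 0"
  by (simp add: F_def subdiag_def)

lemma diag_even: "i \<ge> 1 \<Longrightarrow> diag (2 * i) n = F i n + F i (Suc n)"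
  using diag_eq[of "2 * i - 1" n] by (simp add: F_def)

lemma F_1: "n \<ge> 1 \<Longrightarrow> F 1 n = bet n"
  using subdiag_convolution[of n 1] by (simp add: F_def diag_0 subdiag_even)

text \<open>Parity leaves even \<open>diag\<close> and odd \<open>subdiag\<close> indices in the
  convolution at \<open>2 * k - 1\<close>. The end terms of the \<open>diag\<close> sum are
  separated because \<open>diag 0 n\<close> is 1 and not a sum of F values.\<close>

lemma F_quadratic:
  assumes "n \<ge> 1" "k \<ge> 2"
  shows "F k n = bet n * (F (k - 1) (n - 1) + 2 * F (k - 1) n + F (k - 1) (Suc n))
     + bet n * (\<Sum>i = 1..k - 2. (F i n + F i (Suc n)) * (F (k - 1 - i) (n - 1) + F (k - 1 - i) n))
     - (\<Sum>i = 1..k - 1. F i n * F (k - i) n)"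
proof -
  \<comment> \<open>One vanishing term makes the length even for \<open>sum_double_split\<close>:
    \<open>diag\<close> has an odd index there, and truncated subtraction turns the other
    \<open>subdiag\<close> factor into \<open>subdiag 0 n = 0\<close>.\<close>
  have extend: "(\<Sum>l<2 * k - 1. g l) = (\<Sum>l<2 * k. g l)" if "g (2 * k - 1) = 0" for g :: "nat \<Rightarrow> real"
  proof -
    have "{..<2 * k} = insert (2 * k - 1) {..<2 * k - 1}" using assms by auto
    thus ?thesis using that by simp
  qed
  have "(\<Sum>l<2 * k - 1. diag l n * diag (2 * k - 1 - 1 - l) (n - 1))
      = (\<Sum>l<2 * k. diag l n * diag (2 * k - 1 - 1 - l) (n - 1))"
    using assms by (intro extend) (simp add: diag_odd)
  also have "\<dots> = (\<Sum>i<k. diag (2 * i) n * diag (2 * (k - 1 - i)) (n - 1))"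
    unfolding sum_double_split by (simp add: diag_odd diff_mult_distrib2)
  also have "{..<k} = insert 0 (insert (k - 1) {1..k - 2})"
    using assms by auto
  also have "(\<Sum>i\<in>insert 0 (insert (k - 1) {1..k - 2}). diag (2 * i) n * diag (2 * (k - 1 - i)) (n - 1)) =
      diag (2 * (k - 1)) (n - 1) + diag (2 * (k - 1)) n
      + (\<Sum>i = 1..k - 2. diag (2 * i) n * diag (2 * (k - 1 - i)) (n - 1))"
  proof -
    have "0 \<notin> insert (k - 1) {1..k - 2}" "k - 1 \<notin> {1..k - 2}" using assms by auto
    thus ?thesis by (simp add: diag_0 del: atLeastAtMost_iff)
  qed
  also have "\<dots> = F (k - 1) (n - 1) + 2 * F (k - 1) n + F (k - 1) (Suc n)
      + (\<Sum>i = 1..k - 2. (F i n + F i (Suc n)) * (F (k - 1 - i) (n - 1) + F (k - 1 - i) n))"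
  proof (rule arg_cong2[where f = "(+)"])
    show "diag (2 * (k - 1)) (n - 1) + diag (2 * (k - 1)) n = F (k - 1) (n - 1) + 2 * F (k - 1) n + F (k - 1) (Suc n)"
      using assms by (simp add: diag_even)
    show "(\<Sum>i = 1..k - 2. diag (2 * i) n * diag (2 * (k - 1 - i)) (n - 1)) =
        (\<Sum>i = 1..k - 2. (F i n + F i (Suc n)) * (F (k - 1 - i) (n - 1) + F (k - 1 - i) n))"
    proof (rule sum.cong)
      fix i assume "i \<in> {1..k - 2}"
      hence "i \<ge> 1" "k - 1 - i \<ge> 1" by auto
      thus "diag (2 * i) n * diag (2 * (k - 1 - i)) (n - 1) =
          (F i n + F i (Suc n)) * (F (k - 1 - i) (n - 1) + F (k - 1 - i) n)"
        using assms(1) by (simp only: diag_even) simp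
    qed simp
  qed
  finally have 1: "(\<Sum>l<2 * k - 1. diag l n * diag (2 * k - 1 - 1 - l) (n - 1)) = \<dots>" .
  have "(\<Sum>l<2 * k - 1. subdiag l n * subdiag (2 * k - 1 - 1 - l) n) = (\<Sum>l<2 * k. subdiag l n * subdiag (2 * k - 1 - 1 - l) n)"
    using assms by (intro extend) (simp add: subdiag_even)
  also have "\<dots> = (\<Sum>i = 1..k. subdiag (2 * i - 1) n * subdiag (2 * k - 1 - 1 - (2 * i - 1)) n)"
    unfolding sum_double_split by (simp add: subdiag_even)
  also have "\<dots> = (\<Sum>i = 1..k - 1. subdiag (2 * i - 1) n * subdiag (2 * k - 1 - 1 - (2 * i - 1)) n)"
  proof -
    have "{1..k} = insert k {1..k - 1}" using assms by auto
    thus ?thesis using assms by (simp add: subdiag_even)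
  qed
  also have "\<dots> = (\<Sum>i = 1..k - 1. F i n * F (k - i) n)"
  proof (rule sum.cong)
    fix i assume "i \<in> {1..k - 1}"
    hence "2 * k - 1 - 1 - (2 * i - 1) = 2 * (k - i) - 1" by auto
    thus "subdiag (2 * i - 1) n * subdiag (2 * k - 1 - 1 - (2 * i - 1)) n = F i n * F (k - i) n"
      by (simp only: F_def)
  qed simp
  finally have 2: "(\<Sum>l<2 * k - 1. subdiag l n * subdiag (2 * k - 1 - 1 - l) n) = \<dots>" .
  show ?thesis
    unfolding F_def[of k n] subdiag_convolution[OF assms(1), of "2 * k - 1"] 1 2
    by (simp only: distrib_left)
qed

lemma Fcoef_eq:
  assumes "k \<ge> 1"
  shows "Fcoef (\<lambda>n. bet (nat n)) k n = F k (nat n)"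
  using assms
proof (induction k arbitrary: n rule: less_induct)
  case (less k)
  let ?\<beta> = "\<lambda>n. bet (nat n)"
  show ?case
  proof (cases "k = 1")
    case True
    thus ?thesis
      by (cases "n \<ge> 1") (auto simp: Fcoef.simps[of _ "Suc 0"] F_1[simplified] bet_def[of 0])
  next
    case False
    with less.prems have k: "k \<ge> 2" by simp
    have IH: "Fcoef ?\<beta> i l = F i (nat l)" if "1 \<le> i" "i < k" for i l
      using less.IH that by blast
    have "Fcoef ?\<beta> k n = bet (nat n) * (F (k - 1) (nat (n - 1)) + 2 * F (k - 1) (nat n) + F (k - 1) (nat (n + 1)))
         + bet (nat n) * (\<Sum>i = 1..k - 2. (F i (nat n) + F i (nat (n + 1))) *
                                 (F (k - 1 - i) (nat (n - 1)) + F (k - 1 - i) (nat n)))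
         - (\<Sum>i = 1..k - 1. F i (nat n) * F (k - i) (nat n))"
    proof -
      have "(\<Sum>i = 1..k - 2. (Fcoef ?\<beta> i n + Fcoef ?\<beta> i (n + 1)) *
              (Fcoef ?\<beta> (k - 1 - i) (n - 1) + Fcoef ?\<beta> (k - 1 - i) n)) =
          (\<Sum>i = 1..k - 2. (F i (nat n) + F i (nat (n + 1))) *
              (F (k - 1 - i) (nat (n - 1)) + F (k - 1 - i) (nat n)))"
      proof (intro sum.cong refl)
        fix i assume "i \<in> {1..k - 2}"
        hence "1 \<le> i" "i < k" "1 \<le> k - 1 - i" "k - 1 - i < k" by auto
        thus "(Fcoef ?\<beta> i n + Fcoef ?\<beta> i (n + 1)) *
            (Fcoef ?\<beta> (k - 1 - i) (n - 1) + Fcoef ?\<beta> (k - 1 - i) n) =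
          (F i (nat n) + F i (nat (n + 1))) * (F (k - 1 - i) (nat (n - 1)) + F (k - 1 - i) (nat n))"
          by (simp only: IH)
      qed
      moreover have "(\<Sum>i = 1..k - 1. Fcoef ?\<beta> i n * Fcoef ?\<beta> (k - i) n) =
          (\<Sum>i = 1..k - 1. F i (nat n) * F (k - i) (nat n))"
      proof (intro sum.cong refl)
        fix i assume "i \<in> {1..k - 1}"
        hence "1 \<le> i" "i < k" "1 \<le> k - i" "k - i < k" by auto
        thus "Fcoef ?\<beta> i n * Fcoef ?\<beta> (k - i) n = F i (nat n) * F (k - i) (nat n)"
          by (simp only: IH)
      qed
      moreover have "1 \<le> k - 1" "k - 1 < k" "k \<noteq> 0" "k \<noteq> 1" using k by auto
      ultimately show ?thesis
        by (subst Fcoef.simps) (simp only: IH if_False)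
    qed
    also have "\<dots> = F k (nat n)"
    proof (cases "n \<ge> 1")
      case True
      hence "nat (n - 1) = nat n - 1" "nat (n + 1) = Suc (nat n)" by auto
      thus ?thesis using F_quadratic[of "nat n" k] True k by simp
    next
      \<comment> \<open>Here \<open>nat n = 0\<close>, so every term contains a factor
        \<open>bet 0\<close> or \<open>F i 0\<close>.\<close>
      case False
      thus ?thesis by (simp add: bet_def)
    qed
    finally show ?thesis .
  qed
qed

end

subsection \<open>Ladder relations\<close>

text \<open>The factor x brings the exponents into the form in which they occur in
  \<open>poly_T\<close>, and both sums merge into one over \<open>k\<close> since the inner sum is
  empty for \<open>k = 1\<close>.\<close>

lemma mult_Acoef:
  "x * Acoef m t \<beta> n x = (\<Sum>k = 1..m. 2 * real k * t k *
     (x ^ (2 * k - 1) + (\<Sum>i = 1..k - 1. (Fcoef \<beta> i (int n) + Fcoef \<beta> i (int n + 1)) * x ^ (2 * k - 1 - 2 * i))))"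
proof -
  have "x * Acoef m t \<beta> n x = 
      (\<Sum>k = 2..m. \<Sum>i = 1..k - 1. 2 * real k * t k * (Fcoef \<beta> i (int n) + Fcoef \<beta> i (int n + 1)) * x ^ (2 * k - 1 - 2 * i))
     + (\<Sum>k = 1..m. 2 * real k * t k * x ^ (2 * k - 1))"
    unfolding Acoef_def distrib_left[of x] sum_distrib_left
  proof (intro arg_cong2[where f = "(+)"] sum.cong refl)
    fix k i assume "k \<in> {2..m}" "i \<in> {1..k - 1}"
    hence "2 * k - 1 - 2 * i = Suc (2 * (k - 1 - i))" by auto
    thus "x * (2 * real k * t k * (Fcoef \<beta> i (int n) + Fcoef \<beta> i (int n + 1)) * x ^ (2 * (k - 1 - i))) =
       2 * real k * t k * (Fcoef \<beta> i (int n) + Fcoef \<beta> i (int n + 1)) * x ^ (2 * k - 1 - 2 * i)"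
      by (simp only: power_Suc mult_ac)
  next
    fix k assume "k \<in> {1..m}"
    hence "2 * k - 1 = Suc (2 * k - 2)" by auto
    thus "x * (2 * real k * t k * x ^ (2 * k - 2)) = 2 * real k * t k * x ^ (2 * k - 1)"
      by (simp only: power_Suc mult_ac)
  qed
  also have "(\<Sum>k = 2..m. \<Sum>i = 1..k - 1. 2 * real k * t k * (Fcoef \<beta> i (int n) + Fcoef \<beta> i (int n + 1)) * x ^ (2 * k - 1 - 2 * i))
     = (\<Sum>k = 1..m. \<Sum>i = 1..k - 1. 2 * real k * t k * (Fcoef \<beta> i (int n) + Fcoef \<beta> i (int n + 1)) * x ^ (2 * k - 1 - 2 * i))"
    by (rule sum.mono_neutral_left) (auto simp: not_le numeral_2_eq_2 less_Suc_eq_le)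
  finally show ?thesis
    by (simp add: algebra_simps sum.distrib sum_distrib_left)
qed

lemma mult_Bcoef:
  assumes "x \<noteq> 0"
  shows "x * Bcoef m t lam \<beta> n x = (\<Sum>k = 1..m. 2 * real k * t k *
     (\<Sum>i = 1..k - 1. Fcoef \<beta> i (int n) * x ^ (2 * k - 2 * i))) + (2 * lam + 1) / 2 * (1 - (- 1) ^ n)"
proof -
  have "x * Bcoef m t lam \<beta> n x = 
      (\<Sum>k = 2..m. \<Sum>i = 1..k - 1. 2 * real k * t k * Fcoef \<beta> i (int n) * x ^ (2 * k - 2 * i))
     + (2 * lam + 1) / 2 * (1 - (- 1) ^ n)"
    unfolding Bcoef_def distrib_left[of x] sum_distrib_left
  proof (intro arg_cong2[where f = "(+)"] sum.cong refl)
    fix k i assume "k \<in> {2..m}" "i \<in> {1..k - 1}"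
    hence "2 * k - 2 * i = Suc (2 * (k - i - 1) + 1)" by auto
    thus "x * (2 * real k * t k * Fcoef \<beta> i (int n) * x ^ (2 * (k - i - 1) + 1)) =
       2 * real k * t k * Fcoef \<beta> i (int n) * x ^ (2 * k - 2 * i)"
      by (simp only: power_Suc mult_ac)
  qed (use assms in simp)
  also have "(\<Sum>k = 2..m. \<Sum>i = 1..k - 1. 2 * real k * t k * Fcoef \<beta> i (int n) * x ^ (2 * k - 2 * i))
     = (\<Sum>k = 1..m. \<Sum>i = 1..k - 1. 2 * real k * t k * Fcoef \<beta> i (int n) * x ^ (2 * k - 2 * i))"
    by (rule sum.mono_neutral_left) (auto simp: not_le numeral_2_eq_2 less_Suc_eq_le)
  finally show ?thesis
    by (simp add: sum_distrib_left mult_ac)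
qed

text \<open>\<open>pearson\<close> says that the derivative of x p w integrates to 0, where x w' =
  (2 lam + 1 - sum of 2 k t_k x^(2k)) w.\<close>

locale semiclassical_polys = symmetric_orthogonal_polys +
  fixes m :: nat and t :: "nat \<Rightarrow> real" and lam :: real
  assumes pearson: "L ([:0, 1:] * pderiv p + smult (2 * lam + 2) p) =
    (\<Sum>k = 1..m. 2 * real k * t k * L (monom 1 (2 * k) * p))"
begin

text \<open>\<open>pearson\<close> moves the derivative from \<open>P n\<close> to the test
  polynomial \<open>q\<close>. As x q' is again low, only the potential terms survive, and there
  \<open>T\<close> may replace x^(2k) P_n.\<close>

lemma x_pderiv_P:
  assumes "n \<ge> 1"
  shows "[:0, 1:] * pderiv (P n) = smult (real n) (P n) + (\<Sum>k = 1..m. smult (2 * real k * t k) (T n (2 * k)))"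
proof -
  define X :: "real poly" where "X = [:0, 1:]"
  let ?S = "\<Sum>k = 1..m. smult (2 * real k * t k) (T n (2 * k))"
  let ?r = "X * pderiv (P n) - smult (real n) (P n) - ?S"
  have "?r = 0"
  proof (rule eq_0_if_orth)
    have "low n ([:0, 1:] * pderiv (P n) - smult (coeff ([:0, 1:] * pderiv (P n)) n) (P n))"
      by (intro low_remainder low_x_pderiv low_P)
    moreover have "coeff ([:0, 1:] * pderiv (P n)) n = real n"
      using assms monic_P by (cases n) (auto simp: coeff_pderiv)
    ultimately have "low n (X * pderiv (P n) - smult (real n) (P n))"
      by (simp add: X_def)
    moreover have "low n ?S"
      by (intro low_sum low_smult T_lower_part(1) assms)
    ultimately show "low n ?r"
      by (rule low_diff)
  next
    fix q assume q: "low n q"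
    have "X * pderiv (P n) * q = (X * pderiv (P n * q) + smult (2 * lam + 2) (P n * q))
        - P n * (X * pderiv q) - smult (2 * lam + 2) (P n * q)"
      by (simp add: pderiv_mult algebra_simps)
    also have "L \<dots> = L (X * pderiv (P n * q) + smult (2 * lam + 2) (P n * q))
        - L (P n * (X * pderiv q)) - (2 * lam + 2) * L (P n * q)"
      by (simp only: L_linear)
    also have "L (P n * (X * pderiv q)) = 0"
      unfolding X_def by (intro orth_low low_x_pderiv q)
    also have "L (P n * q) = 0"
      using q by (rule orth_low)
    also have "L (X * pderiv (P n * q) + smult (2 * lam + 2) (P n * q)) =
        (\<Sum>k = 1..m. 2 * real k * t k * L (monom 1 (2 * k) * (P n * q)))"
      unfolding X_def by (rule pearson)
    also have "\<dots> = (\<Sum>k = 1..m. 2 * real k * t k * L (T n (2 * k) * q))"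
      using T_lower_part(2)[OF assms q] by (simp add: algebra_simps L_linear)
    finally show "L (?r * q) = 0"
      using orth_low[OF q] by (simp add: left_diff_distrib sum_distrib_right L_linear)
  qed
  thus ?thesis by (simp add: X_def algebra_simps)
qed

lemma P_odd_factor:
  assumes "odd n" obtains Q where "P n = [:0, 1:] * Q"
proof -
  have "poly (pcompose (P n) [:0, -1:]) 0 = poly (smult ((-1) ^ n) (P n)) 0"
    by (simp only: P_reflect)
  hence "poly (P n) 0 = 0" using assms by (simp add: poly_pcompose)
  thus ?thesis using that by (auto simp: poly_eq_0_iff_dvd elim: dvdE)
qed

text \<open>One of \<open>P n\<close> and \<open>P (n - 1)\<close> is odd, so their product is divisible by \<open>x\<close>.\<close>

lemma string_equation:
  assumes "n \<ge> 1"
  shows "(\<Sum>k = 1..m. 2 * real k * t k * F k n) = real n + (2 * lam + 1) / 2 * (1 - (-1) ^ n)"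
proof -
  define X :: "real poly" where "X = [:0, 1:]"
  \<comment> \<open>For odd \<open>n\<close>, P_n / x is monic of degree \<open>n - 1\<close> and
    pairs with \<open>P (n - 1)\<close> to \<open>h (n - 1)\<close>; for even \<open>n\<close>,
    P_(n-1) / x is low and pairs with \<open>P n\<close> to 0.\<close>
  obtain p where p: "P n * P (n - 1) = X * p" and Lp: "L p = (1 - (-1) ^ n) / 2 * h (n - 1)"
  proof (cases "odd n")
    case True
    obtain Q where Q: "P n = [:0, 1:] * Q" using P_odd_factor[OF True] .
    have "coeff Q k = coeff (P n) (Suc k)" for k by (simp add: Q)
    hence "low n Q" "coeff Q (n - 1) = 1"
      using low_P[of n] monic_P[of n] assms by (auto simp: low_def)
    hence "L (P (n - 1) * Q) = h (n - 1)"
      using assms by (subst L_P_mult) auto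
    thus ?thesis using True by (intro that[of "P (n - 1) * Q"]) (auto simp: X_def Q)
  next
    case False
    hence "odd (n - 1)" using assms by simp
    then obtain Q where Q: "P (n - 1) = [:0, 1:] * Q" using P_odd_factor by blast
    have "coeff Q k = coeff (P (n - 1)) (Suc k)" for k unfolding Q by simp
    hence "low n Q"
      using low_P[of "n - 1"] assms by (auto simp: low_def)
    hence "L (P n * Q) = 0" by (rule orth_low)
    thus ?thesis using False by (intro that[of "P n * Q"]) (auto simp: X_def Q[simplified])
  qed
  \<comment> \<open>This absorbs one copy of \<open>p\<close> in \<open>pearson\<close>, leaving the
    factor \<open>2 * lam + 1\<close>.\<close>
  have "pderiv (P n * P (n - 1)) = X * pderiv p + p"
    unfolding p pderiv_mult by (simp add: X_def pderiv_pCons algebra_simps)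
  hence "pderiv (P n * P (n - 1)) + smult (2 * lam + 1) p = X * pderiv p + smult (2 * lam + 2) p"
    by (intro poly_eqI) (simp add: algebra_simps)
  hence "L (pderiv (P n * P (n - 1))) + (2 * lam + 1) * L p = L (X * pderiv p + smult (2 * lam + 2) p)"
    by (simp flip: L_linear)
  also have "\<dots> = (\<Sum>k = 1..m. 2 * real k * t k * L (monom 1 (2 * k) * p))"
    unfolding X_def by (rule pearson)
  also have "\<dots> = (\<Sum>k = 1..m. 2 * real k * t k * F k n) * h (n - 1)"
    unfolding sum_distrib_right
  proof (intro sum.cong refl)
    fix k assume "k \<in> {1..m}"
    hence "monom 1 (2 * k) = X * monom 1 (2 * k - 1)"
      unfolding X_def monom_mult_x by simp
    hence "monom 1 (2 * k) * p = monom 1 (2 * k - 1) * P n * P (n - 1)"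
      using p by (simp add: mult_ac)
    thus "2 * real k * t k * L (monom 1 (2 * k) * p) = 2 * real k * t k * F k n * h (n - 1)"
      using assms by (simp add: F_def subdiag_def)
  qed
  also have "L (pderiv (P n * P (n - 1))) = L (P (n - 1) * pderiv (P n)) + L (P n * pderiv (P (n - 1)))"
    by (simp add: pderiv_mult L_linear algebra_simps)
  also have "L (P (n - 1) * pderiv (P n)) = real n * h (n - 1)"
    using low_P[of n] assms monic_P[of n]
    by (subst L_P_mult) (auto simp: low_def coeff_pderiv)
  also have "L (P n * pderiv (P (n - 1))) = 0"
    using low_P[of "n - 1"] by (intro orth_low) (auto simp: low_def coeff_pderiv)
  finally have "(real n + (2 * lam + 1) / 2 * (1 - (-1) ^ n)) * h (n - 1) =
      (\<Sum>k = 1..m. 2 * real k * t k * F k n) * h (n - 1)"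
    by (simp add: Lp algebra_simps)
  thus ?thesis by simp
qed

abbreviation \<beta> :: "int \<Rightarrow> real" where "\<beta> \<equiv> \<lambda>n. bet (nat n)"

lemma poly_T:
  "poly (T n (2 * k)) x =
     bet n * (\<Sum>i<k. diag (2 * i) n * x ^ (2 * k - 1 - 2 * i)) * poly (P (n - 1)) x
     - (\<Sum>i = 1..k. F i n * x ^ (2 * k - 2 * i)) * poly (P n) x"
proof -
  have "poly (T n (2 * k)) x = bet n * (\<Sum>l<2 * k. diag l n * x ^ (2 * k - 1 - l)) * poly (P (n - 1)) x
      - (\<Sum>l<2 * k. subdiag l n * x ^ (2 * k - 1 - l)) * poly (P n) x"
    by (simp add: T_def poly_sum poly_monom sum_distrib_left sum_distrib_right sum_subtractf algebra_simps)
  also have "(\<Sum>l<2 * k. diag l n * x ^ (2 * k - 1 - l)) = (\<Sum>i<k. diag (2 * i) n * x ^ (2 * k - 1 - 2 * i))"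
    unfolding sum_double_split by (simp add: diag_odd)
  also have "(\<Sum>l<2 * k. subdiag l n * x ^ (2 * k - 1 - l)) = (\<Sum>i = 1..k. F i n * x ^ (2 * k - 2 * i))"
    unfolding sum_double_split by (auto simp: subdiag_even F_def intro!: sum.cong)
  finally show ?thesis .
qed

lemma lowering:
  assumes "x \<noteq> 0"
  shows "poly (pderiv (P n)) x = 
    - Bcoef m t lam \<beta> n x * poly (P n) x + bet n * Acoef m t \<beta> n x * poly (P (n - 1)) x"
proof (cases "n = 0")
  case True
  \<comment> \<open>All terms vanish at index 0. The case is needed because the raising relation is
    later used at \<open>n - 1\<close>.\<close>
  have "pderiv (P 0) = 0" using degree_P[of 0] by (simp add: pderiv_eq_0_iff)
  moreover have "Bcoef m t lam \<beta> 0 x = 0" by (simp add: Bcoef_def Fcoef_eq)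
  ultimately show ?thesis using True by (simp add: bet_def)
next
  case False
  hence n: "n \<ge> 1" by simp
  have A: "x * Acoef m t \<beta> n x = (\<Sum>k = 1..m. 2 * real k * t k * (\<Sum>i<k. diag (2 * i) n * x ^ (2 * k - 1 - 2 * i)))"
    unfolding mult_Acoef
  proof (intro sum.cong refl arg_cong2[where f = "(*)"])
    fix k assume "k \<in> {1..m}"
    hence "{..<k} = insert 0 {1..k - 1}" by auto
    thus "x ^ (2 * k - 1) + (\<Sum>i = 1..k - 1. (Fcoef \<beta> i (int n) + Fcoef \<beta> i (int n + 1)) * x ^ (2 * k - 1 - 2 * i))
       = (\<Sum>i<k. diag (2 * i) n * x ^ (2 * k - 1 - 2 * i))"
      by (simp add: diag_0 diag_even Fcoef_eq nat_add_distrib)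
  qed
  \<comment> \<open>The terms with \<open>i = k\<close> are free of x; by the string equation they
    add up to \<open>n\<close> plus the parity constant of \<open>Bcoef\<close>.\<close>
  have B: "x * Bcoef m t lam \<beta> n x = (\<Sum>k = 1..m. 2 * real k * t k * (\<Sum>i = 1..k. F i n * x ^ (2 * k - 2 * i))) - real n"
  proof -
    have "(\<Sum>i = 1..k. F i n * x ^ (2 * k - 2 * i)) = 
        (\<Sum>i = 1..k - 1. Fcoef \<beta> i (int n) * x ^ (2 * k - 2 * i)) + F k n" if "k \<in> {1..m}" for k
    proof -
      have "(\<Sum>i = 1..k. F i n * x ^ (2 * k - 2 * i)) =
          (\<Sum>i = 1..k - 1. F i n * x ^ (2 * k - 2 * i)) + F k n"
        using that by (cases k) auto
      thus ?thesis by (simp add: Fcoef_eq)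
    qed
    hence "(\<Sum>k = 1..m. 2 * real k * t k * (\<Sum>i = 1..k. F i n * x ^ (2 * k - 2 * i))) =
       (\<Sum>k = 1..m. 2 * real k * t k * (\<Sum>i = 1..k - 1. Fcoef \<beta> i (int n) * x ^ (2 * k - 2 * i)))
       + (\<Sum>k = 1..m. 2 * real k * t k * F k n)"
      by (simp add: distrib_left sum.distrib)
    thus ?thesis
      unfolding string_equation[OF n] mult_Bcoef[OF assms] by simp
  qed
  have "x * poly (pderiv (P n)) x = poly ([:0, 1:] * pderiv (P n)) x" by simp
  also have "\<dots> = - (x * Bcoef m t lam \<beta> n x) * poly (P n) x 
      + bet n * (x * Acoef m t \<beta> n x) * poly (P (n - 1)) x"
  proof -
    define a where "a k = (\<Sum>i<k. diag (2 * i) n * x ^ (2 * k - 1 - 2 * i))" for k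
    define b where "b k = (\<Sum>i = 1..k. F i n * x ^ (2 * k - 2 * i))" for k
    have T: "poly (T n (2 * k)) x = bet n * a k * poly (P (n - 1)) x - b k * poly (P n) x" for k
      unfolding a_def b_def by (rule poly_T)
    show ?thesis
      unfolding x_pderiv_P[OF n] A B a_def[symmetric] b_def[symmetric] poly_add poly_smult poly_sum T
      by (simp add: algebra_simps sum_distrib_left sum_subtractf)
  qed
  also have "\<dots> = x * (- Bcoef m t lam \<beta> n x * poly (P n) x + bet n * Acoef m t \<beta> n x * poly (P (n - 1)) x)"
    by (simp add: algebra_simps)
  finally show ?thesis using assms by simp
qed

lemma raising:
  assumes "x \<noteq> 0"
  defines "V' \<equiv> (\<Sum>k = 1..m. 2 * real k * t k * x ^ (2 * k - 1)) - (2 * lam + 1) / x"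
  shows "poly (pderiv (P n)) x = 
    (Bcoef m t lam \<beta> (Suc n) x + V') * poly (P n) x - Acoef m t \<beta> n x * poly (P (Suc n)) x"
proof -
  have sum_eq: "x * (\<Sum>i = 1..k - 1. (Fcoef \<beta> i (int n) + Fcoef \<beta> i (int n + 1)) * x ^ (2 * k - 1 - 2 * i)) =
      (\<Sum>i = 1..k - 1. Fcoef \<beta> i (int n) * x ^ (2 * k - 2 * i))
      + (\<Sum>i = 1..k - 1. Fcoef \<beta> i (int n + 1) * x ^ (2 * k - 2 * i))" for k
    unfolding sum_distrib_left sum.distrib[symmetric]
  proof (rule sum.cong)
    fix i assume "i \<in> {1..k - 1}"
    hence "2 * k - 2 * i = Suc (2 * k - 1 - 2 * i)" by auto
    thus "x * ((Fcoef \<beta> i (int n) + Fcoef \<beta> i (int n + 1)) * x ^ (2 * k - 1 - 2 * i)) =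
        Fcoef \<beta> i (int n) * x ^ (2 * k - 2 * i) + Fcoef \<beta> i (int n + 1) * x ^ (2 * k - 2 * i)"
      by (simp add: algebra_simps)
  qed simp
  have xA: "x * (x * Acoef m t \<beta> n x - (\<Sum>k = 1..m. 2 * real k * t k * x ^ (2 * k - 1))) =
      (\<Sum>k = 1..m. 2 * real k * t k * (\<Sum>i = 1..k - 1. Fcoef \<beta> i (int n) * x ^ (2 * k - 2 * i)))
      + (\<Sum>k = 1..m. 2 * real k * t k * (\<Sum>i = 1..k - 1. Fcoef \<beta> i (int n + 1) * x ^ (2 * k - 2 * i)))"
    unfolding mult_Acoef sum_subtractf[symmetric] sum_distrib_left[of x] sum.distrib[symmetric]
  proof (rule sum.cong)
    have "x * (a * (b + s) - a * b) = a * (x * s)" for a b s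
      by (simp add: algebra_simps)
    thus "x * (2 * real k * t k * (x ^ (2 * k - 1) + (\<Sum>i = 1..k - 1. (Fcoef \<beta> i (int n) + Fcoef \<beta> i (int n + 1)) * x ^ (2 * k - 1 - 2 * i)))
         - 2 * real k * t k * x ^ (2 * k - 1)) =
        2 * real k * t k * (\<Sum>i = 1..k - 1. Fcoef \<beta> i (int n) * x ^ (2 * k - 2 * i))
        + 2 * real k * t k * (\<Sum>i = 1..k - 1. Fcoef \<beta> i (int n + 1) * x ^ (2 * k - 2 * i))" for k
      by (simp only: sum_eq distrib_left)
  qed simp
  \<comment> \<open>The parity constants at \<open>n\<close> and \<open>Suc n\<close> add up to
    \<open>2 * lam + 1\<close>, the coefficient of the pole of V'.\<close>
  have "x * (Bcoef m t lam \<beta> (Suc n) x + Bcoef m t lam \<beta> n x) = x * (x * Acoef m t \<beta> n x - V')"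
  proof -
    have "x * ((2 * lam + 1) / x) = 2 * lam + 1"
      using assms(1) by simp
    moreover have "(2 * lam + 1) / 2 * (1 - (- 1) ^ Suc n) + (2 * lam + 1) / 2 * (1 - (- 1) ^ n) = 2 * lam + 1"
      by (simp add: field_simps)
    ultimately show ?thesis
      using xA
      unfolding of_nat_Suc add.commute[of 1 "int n"] distrib_left[of x] right_diff_distrib[of x] mult_Bcoef[OF assms(1)] V'_def
      by linarith
  qed
  hence "Bcoef m t lam \<beta> (Suc n) x + Bcoef m t lam \<beta> n x = x * Acoef m t \<beta> n x - V'"
    using assms(1) by simp
  hence B: "Bcoef m t lam \<beta> n x = x * Acoef m t \<beta> n x - V' - Bcoef m t lam \<beta> (Suc n) x"
    by simp
  have "poly ([:0, 1:] * P n) x = poly (P (Suc n) + smult (bet n) (P (n - 1))) x"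
    by (simp only: recurrence)
  hence rec: "bet n * poly (P (n - 1)) x = x * poly (P n) x - poly (P (Suc n)) x"
    by simp
  have "poly (pderiv (P n)) x = - Bcoef m t lam \<beta> n x * poly (P n) x
      + Acoef m t \<beta> n x * (bet n * poly (P (n - 1)) x)"
    using lowering[OF assms(1)] by simp
  thus ?thesis unfolding rec B by (simp add: algebra_simps)
qed

end

lemma (in symmetric_orthogonal_polys) rec_coeff_eq: "rec_coeff P = (\<lambda>n. bet (nat n))"
proof
  fix n
  have "b = bet (nat n)" if "[:0, 1:] * P (nat n) = P (nat n + 1) + smult b (P (nat n - 1))" for b
  proof -
    have "smult b (P (nat n - 1)) = smult (bet (nat n)) (P (nat n - 1))"
      using that unfolding recurrence by simp
    \<comment> \<open>Uniqueness of the coefficient: compare leading coefficients of the monic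
      \<open>P (nat n - 1)\<close>.\<close>
    from arg_cong[OF this, of "\<lambda>p. coeff p (nat n - 1)"] show ?thesis
      by (simp only: coeff_smult monic_P mult_1_right)
  qed
  moreover have "[:0, 1:] * P (nat n) = P (nat n + 1) + smult (bet (nat n)) (P (nat n - 1))"
    unfolding recurrence by simp
  ultimately have "(THE b. [:0, 1:] * P (nat n) = P (nat n + 1) + smult b (P (nat n - 1))) = bet (nat n)"
    by (intro the_equality)
  thus "rec_coeff P n = bet (nat n)"
    unfolding rec_coeff_def by (auto simp: bet_def)
qed

subsection \<open>The differential equation\<close>

lemma has_real_derivative_ln_abs:
  assumes "x \<noteq> 0"
  shows "((\<lambda>x. ln \<bar>x\<bar>) has_real_derivative 1 / x) (at x)"
proof -
  \<comment> \<open>The square removes the case distinction on the sign; at \<open>y = 0\<close> the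
    identity rests on the value \<open>ln 0 = 0\<close>.\<close>
  have eq: "ln \<bar>y\<bar> = ln (y ^ 2) / 2" for y :: real
    using ln_realpow[of "\<bar>y\<bar>" 2] by (cases "y = 0") auto
  have "((\<lambda>y. ln (y ^ 2) / 2) has_real_derivative 1 / x) (at x)"
    using assms by (auto intro!: derivative_eq_intros simp: power2_eq_square zero_less_mult_iff)
  thus ?thesis unfolding eq .
qed

lemma deriv_Vpot:
  assumes "x \<noteq> 0"
  shows "deriv (Vpot m t lam) x = (\<Sum>k = 1..m. 2 * real k * t k * x ^ (2 * k - 1)) - (2 * lam + 1) / x"
proof -
  have "((\<lambda>x. \<Sum>k = 1..m. t k * x ^ (2 * k)) has_real_derivative
      (\<Sum>k = 1..m. 2 * real k * t k * x ^ (2 * k - 1))) (at x)"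
    by (auto intro!: derivative_eq_intros sum.cong)
  from DERIV_diff[OF this DERIV_cmult[OF has_real_derivative_ln_abs[OF assms], of "2 * lam + 1"]]
  have "(Vpot m t lam has_real_derivative
      (\<Sum>k = 1..m. 2 * real k * t k * x ^ (2 * k - 1)) - (2 * lam + 1) / x) (at x)"
    unfolding Vpot_def[abs_def] by simp
  thus ?thesis by (rule DERIV_imp_deriv)
qed

lemma has_real_derivative_Acoef:
  "(Acoef m t \<beta> n has_real_derivative deriv (Acoef m t \<beta> n) x) (at x)"
proof -
  have "Acoef m t \<beta> n field_differentiable (at x)"
    unfolding Acoef_def[abs_def] by (intro derivative_intros)
  thus ?thesis by (simp add: field_differentiable_derivI)
qed

lemma has_real_derivative_Bcoef:
  assumes "x \<noteq> 0"
  shows "(Bcoef m t lam \<beta> n has_real_derivative deriv (Bcoef m t lam \<beta> n) x) (at x)"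
proof -
  have "Bcoef m t lam \<beta> n field_differentiable (at x)"
    unfolding Bcoef_def[abs_def] using assms by (intro derivative_intros) auto
  thus ?thesis by (simp add: field_differentiable_derivI)
qed

context semiclassical_polys
begin

lemma second_order_ode:
  assumes "n \<ge> 1" and x: "x \<noteq> 0" and A0: "Acoef m t \<beta> n x \<noteq> 0"
  shows "poly (pderiv (pderiv (P n))) x
    - (deriv (Vpot m t lam) x + deriv (Acoef m t \<beta> n) x / Acoef m t \<beta> n x) * poly (pderiv (P n)) x
    + (deriv (Bcoef m t lam \<beta> n) x - (Bcoef m t lam \<beta> n x)\<^sup>2 - deriv (Vpot m t lam) x * Bcoef m t lam \<beta> n x
       + \<beta> (int n) * Acoef m t \<beta> n x * Acoef m t \<beta> (n - 1) x
       - deriv (Acoef m t \<beta> n) x * Bcoef m t lam \<beta> n x / Acoef m t \<beta> n x) * poly (P n) x = 0"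
proof -
  define A B A' B' V' where "A = Acoef m t \<beta> n x" and "B = Bcoef m t lam \<beta> n x"
    and "A' = deriv (Acoef m t \<beta> n) x" and "B' = deriv (Bcoef m t lam \<beta> n) x"
    and "V' = deriv (Vpot m t lam) x"
  define p p' p'' q q' where "p = poly (P n) x" and "p' = poly (pderiv (P n)) x"
    and "p'' = poly (pderiv (pderiv (P n))) x"
    and "q = poly (P (n - 1)) x" and "q' = poly (pderiv (P (n - 1))) x"
  note defs = A_def B_def A'_def B'_def V'_def p_def p'_def p''_def q_def q'_def
  have lower: "p' = - B * p + bet n * A * q"
    unfolding defs by (rule lowering[OF x])
  \<comment> \<open>At index \<open>n - 1\<close> the raising relation contains \<open>Bcoef\<close>
    at \<open>n\<close>, the same \<open>B\<close> as in the lowering relation.\<close>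
  have raise: "q' = (B + V') * q - Acoef m t \<beta> (n - 1) x * p"
  proof -
    have "Suc (n - 1) = n" using assms(1) by simp
    thus ?thesis using raising[OF x, of "n - 1"] unfolding defs deriv_Vpot[OF x] by (simp only:)
  qed
  have dA: "(Acoef m t \<beta> n has_real_derivative A') (at x)"
    unfolding A'_def by (rule has_real_derivative_Acoef)
  have dB: "(Bcoef m t lam \<beta> n has_real_derivative B') (at x)"
    unfolding B'_def by (rule has_real_derivative_Bcoef[OF x])
  have dp: "(poly (P n) has_real_derivative p') (at x)"
    unfolding p'_def by (rule poly_DERIV)
  have dq: "(poly (P (n - 1)) has_real_derivative q') (at x)"
    unfolding q'_def by (rule poly_DERIV)
  have "((\<lambda>y. - Bcoef m t lam \<beta> n y * poly (P n) y + bet n * Acoef m t \<beta> n y * poly (P (n - 1)) y)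
      has_real_derivative (- B' * p - B * p' + bet n * (A' * q + A * q'))) (at x)"
    by (rule DERIV_cong, rule DERIV_add[OF DERIV_mult[OF DERIV_minus[OF dB] dp] DERIV_mult[OF DERIV_cmult[OF dA] dq]])
       (simp add: A_def B_def p_def q_def algebra_simps)
  \<comment> \<open>The lowering relation holds off 0, hence on a neighbourhood of \<open>x\<close>,
    which suffices for differentiating it.\<close>
  moreover have "eventually (\<lambda>y. - Bcoef m t lam \<beta> n y * poly (P n) y + bet n * Acoef m t \<beta> n y * poly (P (n - 1)) y
      = poly (pderiv (P n)) y) (nhds x)"
    using t1_space_nhds[OF x] by eventually_elim (simp add: lowering)
  ultimately have "(poly (pderiv (P n)) has_real_derivative (- B' * p - B * p' + bet n * (A' * q + A * q'))) (at x)"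
    by (rule iffD1[OF DERIV_cong_ev[OF refl _ refl], rotated])
  hence second: "p'' = - B' * p - B * p' + bet n * (A' * q + A * q')"
    unfolding p''_def by (rule DERIV_unique[OF poly_DERIV])
  have "A \<noteq> 0" using A0 by (simp add: A_def)
  have q: "bet n * q = (p' + B * p) / A"
    using \<open>A \<noteq> 0\<close> lower by (simp add: field_simps)
  have Aq: "A * (bet n * q) = p' + B * p"
    using lower by (simp add: algebra_simps)
  have A'q: "A' * (bet n * q) = A' / A * p' + A' * B / A * p"
    unfolding q by (simp add: add_divide_distrib algebra_simps)
  have "p'' = - B' * p - B * p' + A' * (bet n * q) + (B + V') * (A * (bet n * q)) - bet n * A * Acoef m t \<beta> (n - 1) x * p"
    unfolding second raise by (simp add: algebra_simps)
  hence "p'' - (V' + A' / A) * p' + (B' - B\<^sup>2 - V' * B + bet n * A * Acoef m t \<beta> (n - 1) x - A' * B / A) * p = 0"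
    unfolding Aq A'q by (simp add: algebra_simps power2_eq_square)
  thus ?thesis unfolding defs by (simp only: nat_int)
qed

end

subsection \<open>The weight\<close>

lemma weight_nonneg: "weight m t lam x \<ge> 0"
  by (simp add: weight_def)

lemma weight_pos: "x \<noteq> 0 \<Longrightarrow> weight m t lam x > 0"
  by (simp add: weight_def)

lemma weight_uminus [simp]: "weight m t lam (- x) = weight m t lam x"
  by (simp add: weight_def)

lemma borel_measurable_weight [measurable]: "weight m t lam \<in> borel_measurable borel"
  unfolding weight_def[abs_def] by measurable

lemma integrable_powr_near_0:
  assumes "a > -1" "R \<ge> 0"
  shows "integrable lborel (\<lambda>x::real. indicator {0..R} x * x powr a)"
proof -
  have "(\<lambda>x. x powr a) absolutely_integrable_on {0..R}"
    by (rule nonnegative_absolutely_integrable_1) (use assms in \<open>auto intro: integrable_on_powr_from_0\<close>)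
  thus ?thesis
    unfolding set_integrable_def by (subst (asm) integrable_completion) auto
qed

text \<open>Orthogonality only provides integrability of \<open>P\<^sub>i P\<^sub>j w\<close> for \<open>i \<noteq> j\<close>. Here \<open>x + b\<close> is \<open>P\<^sub>1 P\<^sub>0\<close>,
  which controls \<open>w\<close> away from \<open>-b\<close>.\<close>

lemma weight_integrable:
  assumes "lam > -1" and lin: "integrable lborel (\<lambda>x. (x + b) * weight m t lam x)"
  shows "integrable lborel (weight m t lam)"
proof -
  \<comment> \<open>Chosen so that \<bar>x + b\<bar> \<ge> 1 outside [-R, R]; inside, the weight is
    at most a bound on \<open>e\<close> times an integrable power.\<close>
  define R where "R = \<bar>b\<bar> + 1"
  define e where "e x = exp (- (\<Sum>k = 1..m. t k * x ^ (2 * k)))" for x :: real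
  define f where "f x = indicator {0..R} x * x powr (2 * lam + 1)" for x :: real
  have "bounded (e ` {- R..R})"
    unfolding e_def by (intro compact_imp_bounded compact_continuous_image continuous_intros) auto
  then obtain K where K: "\<And>x. x \<in> {-R..R} \<Longrightarrow> e x \<le> K"
    unfolding bounded_iff by (metis abs_le_D1 imageI real_norm_def)
  have f: "integrable lborel f"
    unfolding f_def by (rule integrable_powr_near_0) (use assms in \<open>auto simp: R_def\<close>)
  have f': "integrable lborel (\<lambda>x. f (- x))"
    using lborel_integrable_real_affine[OF f, of "-1" 0] by simp
  show ?thesis
  proof (rule Bochner_Integration.integrable_bound)
    show "integrable lborel (\<lambda>x. \<bar>(x + b) * weight m t lam x\<bar> + K * (f x + f (- x)))"
      by (intro Bochner_Integration.integrable_add integrable_abs lin integrable_mult_right f f')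
    have "weight m t lam x \<le> \<bar>(x + b) * weight m t lam x\<bar> + K * (f x + f (- x))" for x
    proof (cases "\<bar>x\<bar> \<le> R")
      case True
      hence x: "x \<in> {-R..R}" by auto
      have "K \<ge> 0" using K[OF x] by (simp add: e_def order.trans[OF exp_ge_zero])
      have "weight m t lam x = \<bar>x\<bar> powr (2 * lam + 1) * e x"
        by (simp add: weight_def e_def)
      also have "\<dots> \<le> \<bar>x\<bar> powr (2 * lam + 1) * K"
        by (intro mult_left_mono K x) auto
      also have "\<bar>x\<bar> powr (2 * lam + 1) \<le> f x + f (- x)"
        using x by (auto simp: f_def indicator_def)
      finally show ?thesis using \<open>K \<ge> 0\<close> by (simp add: mult_right_mono mult.commute add_increasing)
    next
      case False
      hence "1 \<le> \<bar>x + b\<bar>" by (auto simp: R_def)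
      hence "1 * weight m t lam x \<le> \<bar>x + b\<bar> * weight m t lam x"
        by (rule mult_right_mono) (rule weight_nonneg)
      moreover have "f x = 0" "f (- x) = 0" using False by (auto simp: f_def indicator_def)
      ultimately show ?thesis by (simp add: abs_mult weight_nonneg)
    qed
    hence "norm (weight m t lam x) \<le> norm (\<bar>(x + b) * weight m t lam x\<bar> + K * (f x + f (- x)))" for x
      using weight_nonneg[of m t lam x] by (metis abs_ge_self abs_of_nonneg order.trans real_norm_def)
    thus "AE x in lborel. norm (weight m t lam x) \<le> norm (\<bar>(x + b) * weight m t lam x\<bar> + K * (f x + f (- x)))"
      by (intro always_eventually allI)
  qed auto
qed

section \<open>Decay at infinity and integration by parts\<close>

lemma poly_over_exp_tendsto_0: "((\<lambda>x. poly p x / exp x) \<longlongrightarrow> 0) at_top" for p :: "real poly"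
proof -
  have "((\<lambda>x. \<Sum>i\<le>degree p. coeff p i * (x ^ i / exp x)) \<longlongrightarrow> (\<Sum>i\<le>degree p. coeff p i * 0)) at_top"
    by (intro tendsto_intros tendsto_power_div_exp_0)
  thus ?thesis by (simp add: poly_altdef sum_divide_distrib)
qed

text \<open>The potential minus x has positive leading coefficient \<open>t m\<close> because 2 m >
  1. Thus exp(-x) eventually dominates the exponential factor of the weight.\<close>

lemma eventually_le_potential:
  assumes "m \<ge> 1" "t m > 0"
  shows "eventually (\<lambda>x::real. x \<le> (\<Sum>k = 1..m. t k * x ^ (2 * k))) at_top"
proof -
  define Q where "Q = (\<Sum>k = 1..m. monom (t k) (2 * k)) - [:0, 1:]"
  have coeff: "coeff Q (2 * m) = t m"
  proof -
    have "coeff Q (2 * m) = (\<Sum>k = 1..m. if k = m then t k else 0)"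
      using assms by (auto simp: Q_def coeff_sum coeff_pCons split: nat.split intro!: sum.cong)
    thus ?thesis using assms by simp
  qed
  have "coeff Q i = 0" if "i > 2 * m" for i
    using assms that by (auto simp: Q_def coeff_sum coeff_pCons split: nat.split intro!: sum.neutral)
  hence "degree Q = 2 * m"
    using coeff assms by (intro antisym degree_le le_degree) auto
  hence "lead_coeff Q > 0" using coeff assms by simp
  then obtain N where N: "\<And>x. x \<ge> N \<Longrightarrow> poly Q x \<ge> lead_coeff Q"
    using poly_pinfty_gt_lc by blast
  show ?thesis
    using eventually_ge_at_top[of N]
  proof eventually_elim
    case (elim x)
    hence "poly Q x \<ge> 0" using N[of x] \<open>lead_coeff Q > 0\<close> by linarith
    thus ?case by (simp add: Q_def poly_sum poly_monom)
  qed
qed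

text \<open>On x > 0 the integrand is the derivative of x p w, called \<open>G\<close>. It tends to
  0 at the origin since 2 lam + 2 > 0, and at infinity by exponential decay.\<close>

lemma half_line_integral_eq_0:
  fixes p :: "real poly"
  assumes "m \<ge> 1" "t m > 0" "lam > -1"
    and int: "\<And>p. integrable lborel (\<lambda>x. poly p x * weight m t lam x)"
  defines "r \<equiv> \<lambda>p. [:0, 1:] * pderiv p + smult (2 * lam + 2) p - (\<Sum>k = 1..m. monom (2 * real k * t k) (2 * k)) * p"
  shows "(LBINT x:{0<..}. poly (r p) x * weight m t lam x) = 0"
proof -
  define q where "q x = (\<Sum>k = 1..m. t k * x ^ (2 * k))" for x
  define G where "G x = poly p x * x powr (2 * lam + 2) * exp (- q x)" for x
  have powr_Suc: "x powr (2 * lam + 2) = x * x powr (2 * lam + 1)" if "x > 0" for x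
    using that powr_add[of x 1 "2 * lam + 1"] by (simp add: add.commute)
  have G': "(G has_real_derivative poly (r p) x * weight m t lam x) (at x)" if "x > 0" for x
  proof -
    have "(q has_real_derivative (\<Sum>k = 1..m. t k * (real (2 * k) * x ^ (2 * k - 1)))) (at x)"
      unfolding q_def by (auto intro!: derivative_eq_intros sum.cong)
    hence "(G has_real_derivative 
       (poly (pderiv p) x * x powr (2 * lam + 2) + poly p x * ((2 * lam + 2) * x powr (2 * lam + 1)))
         * exp (- q x) - poly p x * x powr (2 * lam + 2) * 
           (exp (- q x) * (\<Sum>k = 1..m. t k * (real (2 * k) * x ^ (2 * k - 1))))) (at x)"
      unfolding G_def using that by (auto intro!: derivative_eq_intros simp: algebra_simps)
    moreover have "poly (\<Sum>k = 1..m. monom (2 * real k * t k) (2 * k)) x =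
        x * (\<Sum>k = 1..m. t k * (real (2 * k) * x ^ (2 * k - 1)))"
      unfolding poly_sum sum_distrib_left poly_monom
    proof (rule sum.cong)
      fix k assume "k \<in> {1..m}"
      hence "x ^ (2 * k) = x * x ^ (2 * k - 1)" by (cases k) auto
      thus "2 * real k * t k * x ^ (2 * k) = x * (t k * (real (2 * k) * x ^ (2 * k - 1)))" by simp
    qed simp
    moreover have "weight m t lam x = x powr (2 * lam + 1) * exp (- q x)"
      using that by (simp add: weight_def q_def)
    ultimately show ?thesis
      using that by (simp add: r_def powr_Suc) (simp add: algebra_simps)
  qed
  have "(LBINT x=ereal 0..\<infinity>. poly (r p) x * weight m t lam x) = 0 - 0"
  proof (rule interval_integral_FTC_integrable[where F = G])
    fix x :: real assume "ereal 0 < ereal x"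
    hence x: "x > 0" by simp
    show "(G has_vector_derivative poly (r p) x * weight m t lam x) (at x)"
      using G'[OF x] by (simp add: has_real_derivative_iff_has_vector_derivative)
    show "isCont (\<lambda>x. poly (r p) x * weight m t lam x) x"
      using x unfolding weight_def by (intro continuous_intros) auto
  next
    have "integrable lborel (\<lambda>x. poly (r p) x * weight m t lam x)" by (rule int)
    thus "set_integrable lborel (einterval (ereal 0) \<infinity>) (\<lambda>x. poly (r p) x * weight m t lam x)"
      unfolding set_integrable_def by (intro integrable_mult_indicator) auto
  next
    have "isCont q 0" unfolding q_def by (intro continuous_intros)
    hence "((\<lambda>x. poly p x * x powr (2 * lam + 2) * exp (- q x)) \<longlongrightarrow> poly p 0 * 0 * exp (- q 0)) (at_right 0)"
      using assms(3) eventually_at_right_less[of 0]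
      by (intro tendsto_mult tendsto_exp tendsto_minus tendsto_zero_powrI[of _ _ _ "2 * lam + 2"])
         (auto simp: isCont_def intro!: tendsto_intros tendsto_within_subset[of _ _ _ UNIV] elim: eventually_mono)
    thus "((G \<circ> real_of_ereal) \<longlongrightarrow> 0) (at_right (ereal 0))"
      unfolding ereal_tendsto_simps1 G_def by simp
  next
    \<comment> \<open>An integer exponent with x powr (2 lam + 2) \<le> x^N for x \<ge> 1, so that
      \<open>G\<close> is dominated by a polynomial over exp.\<close>
    define N where "N = nat \<lceil>2 * lam + 2\<rceil>"
    have "(G \<longlongrightarrow> 0) at_top"
    proof (rule Lim_null_comparison)
      show "((\<lambda>x. \<bar>poly (monom 1 N * p) x / exp x\<bar>) \<longlongrightarrow> 0) at_top"
        by (intro tendsto_rabs_zero poly_over_exp_tendsto_0)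
      show "eventually (\<lambda>x. norm (G x) \<le> \<bar>poly (monom 1 N * p) x / exp x\<bar>) at_top"
        using eventually_le_potential[of m t, OF assms(1,2)] eventually_ge_at_top[of 1]
      proof eventually_elim
        case (elim x)
        have "x powr (2 * lam + 2) \<le> x powr real N"
          using elim by (intro powr_mono) (use real_nat_ceiling_ge[of "2 * lam + 2"] in \<open>simp_all add: N_def\<close>)
        also have "\<dots> = x ^ N" using elim by (simp add: powr_realpow)
        finally have "\<bar>poly p x\<bar> * x powr (2 * lam + 2) * exp (- q x) \<le> \<bar>poly p x\<bar> * x ^ N * exp (- x)"
          using elim by (intro mult_mono) (auto simp: q_def)
        thus ?case using elim by (simp add: G_def abs_mult poly_monom exp_minus divide_inverse mult_ac)
      qed
    qed
    thus "((G \<circ> real_of_ereal) \<longlongrightarrow> 0) (at_left \<infinity>)"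
      unfolding ereal_tendsto_simps1 .
  qed auto
  thus ?thesis by (simp add: interval_integral_to_infinity_eq)
qed

section \<open>The functional given by the weight\<close>

definition weight_functional :: "nat \<Rightarrow> (nat \<Rightarrow> real) \<Rightarrow> real \<Rightarrow> real poly \<Rightarrow> real" where
  "weight_functional m t lam p = (LBINT x. poly p x * weight m t lam x)"

context
  fixes m :: nat and t :: "nat \<Rightarrow> real" and lam :: real and P :: "nat \<Rightarrow> real poly"
  assumes m: "m \<ge> 1" and t: "t m > 0" and lam: "lam > -1"
    and ortho: "monic_orthogonal_polys (weight m t lam) P"
begin

lemma P_degree: "degree (P n) = n" and P_monic: "coeff (P n) n = 1"
  using ortho unfolding monic_orthogonal_polys_def by metis+

lemma P_0: "P 0 = 1"
  using P_degree[of 0] P_monic[of 0] by (metis degree_0_id one_poly_def pCons_one)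

lemma integrable_P_P:
  "i \<noteq> j \<Longrightarrow> integrable lborel (\<lambda>x. poly (P i) x * poly (P j) x * weight m t lam x)"
  using ortho by (auto simp: monic_orthogonal_polys_def has_bochner_integral_iff)

text \<open>Induction on the degree bound, removing multiples of \<open>P n\<close>. For
  \<open>n > 0\<close>, \<open>P n\<close> is the product of \<open>P n\<close> and
  \<open>P 0 = 1\<close>, integrable by assumption; \<open>n = 0\<close> is
  \<open>weight_integrable\<close>.\<close>

lemma integrable_poly_weight: "integrable lborel (\<lambda>x. poly p x * weight m t lam x)"
proof -
  have "low n p \<Longrightarrow> integrable lborel (\<lambda>x. poly p x * weight m t lam x)" for n
  proof (induction n arbitrary: p)
    case (Suc n)
    have "integrable lborel (\<lambda>x. poly (P n) x * weight m t lam x)"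
    proof (cases "n = 0")
      case True
      define b where "b = coeff (P 1) 0"
      have "poly (P 1) x = x + b" for x
        using P_degree[of 1] P_monic[of 1] by (simp add: poly_altdef b_def)
      hence "integrable lborel (\<lambda>x. (x + b) * weight m t lam x)"
        using integrable_P_P[of 1 0] by (simp add: P_0)
      thus ?thesis using True weight_integrable[OF lam] by (simp add: P_0)
    next
      case False
      thus ?thesis using integrable_P_P[of n 0] by (simp add: P_0)
    qed
    moreover have "low n (p - smult (coeff p n) (P n))"
      using Suc.prems P_degree[of n] P_monic[of n]
      by (auto simp: low_def coeff_eq_0 Suc_le_eq)
         (metis coeff_eq_0 le_neq_implies_less mult.right_neutral mult_zero_right)
    hence "integrable lborel (\<lambda>x. poly (p - smult (coeff p n) (P n)) x * weight m t lam x)"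
      by (rule Suc.IH)
    ultimately have "integrable lborel (\<lambda>x. poly (p - smult (coeff p n) (P n)) x * weight m t lam x
        + coeff p n * (poly (P n) x * weight m t lam x))"
      by (intro Bochner_Integration.integrable_add integrable_mult_right)
    thus ?case by (simp add: algebra_simps)
  qed simp
  thus ?thesis using low_degree[of p "Suc (degree p)"] by blast
qed

abbreviation "L \<equiv> weight_functional m t lam"

lemma L_reflect: "L (pcompose p [:0, -1:]) = L p"
proof -
  have "L p = (LBINT x. poly p (- x) * weight m t lam x)"
    unfolding weight_functional_def
    using lborel_integral_real_affine[of "-1" "\<lambda>x. poly p x * weight m t lam x" 0] by simp
  thus ?thesis by (simp add: weight_functional_def poly_pcompose)
qed

text \<open>The integrand is positive off 0 and the roots of \<open>p\<close>, a finite and hence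
  null set, so a zero integral would make the whole line null.\<close>

lemma L_square_pos:
  assumes "p \<noteq> 0" shows "L (p * p) > 0"
proof -
  have nonneg: "poly (p * p) x * weight m t lam x \<ge> 0" for x
    by (simp add: weight_nonneg)
  have "L (p * p) \<noteq> 0"
  proof
    assume "L (p * p) = 0"
    hence "AE x in lborel. poly (p * p) x * weight m t lam x = 0"
      unfolding weight_functional_def
      by (subst (asm) integral_nonneg_eq_0_iff_AE) (use integrable_poly_weight[of "p * p"] nonneg in auto)
    moreover have "AE x in lborel. x \<notin> insert 0 {x. poly p x = 0}"
      using poly_roots_finite[OF assms]
      by (intro AE_not_in countable_imp_null_set_lborel countable_finite) auto
    ultimately have "AE x::real in lborel. False"
    proof eventually_elim
      case (elim x)
      thus ?case using weight_pos[of x m t lam] by auto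
    qed
    thus False by (subst (asm) AE_iff_null) (auto dest: null_setsD1)
  qed
  moreover have "L (p * p) \<ge> 0"
    unfolding weight_functional_def using nonneg by (intro Bochner_Integration.integral_nonneg) auto
  ultimately show ?thesis by simp
qed

lemma L_pearson:
  "L ([:0, 1:] * pderiv p + smult (2 * lam + 2) p) = (\<Sum>k = 1..m. 2 * real k * t k * L (monom 1 (2 * k) * p))"
proof -
  define r where "r p = [:0, 1:] * pderiv p + smult (2 * lam + 2) p
    - (\<Sum>k = 1..m. monom (2 * real k * t k) (2 * k)) * p" for p
  define g where "g p x = poly (r p) x * weight m t lam x" for p x
  have half: "integrable lborel (\<lambda>x. indicator {0<..} x * g p x)"
    "(LBINT x. indicator {0<..} x * g p x) = 0" for p
  proof -
    show "integrable lborel (\<lambda>x. indicator {0<..} x * g p x)"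
      unfolding g_def
      using integrable_mult_indicator[OF _ integrable_poly_weight, of "{0<..}" "r p"] by simp
    show "(LBINT x. indicator {0<..} x * g p x) = 0"
      using half_line_integral_eq_0[OF m t lam integrable_poly_weight, of p]
      by (simp add: g_def r_def set_lebesgue_integral_def)
  qed
  define p' where "p' = pcompose p [:0, -1:]"
  \<comment> \<open>The operator x d/dx and the even powers commute with reflection, so the negative
    half-line reduces to the positive one for the reflected polynomial.\<close>
  have g_reflect: "g p x = g p' (- x)" for x
  proof -
    have "poly (monom a (2 * k)) (- x) = poly (monom a (2 * k)) x" for a :: real and k
      by (simp add: poly_monom)
    moreover have "poly (pderiv p') (- x) = - poly (pderiv p) x"
      by (simp add: p'_def pderiv_pcompose poly_pcompose pderiv_pCons)
    moreover have "poly p' (- x) = poly p x"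
      by (simp add: p'_def poly_pcompose)
    ultimately show ?thesis
      by (simp add: g_def r_def poly_sum)
  qed
  have "L (r p) = (LBINT x. g p x)"
    by (simp add: weight_functional_def g_def)
  also have "\<dots> = (LBINT x. indicator {0<..} x * g p x + indicator {0<..} (- x) * g p' (- x))"
  proof (rule integral_cong_AE)
    show "AE x in lborel. g p x = indicator {0<..} x * g p x + indicator {0<..} (- x) * g p' (- x)"
      using AE_lborel_singleton[of 0]
      by eventually_elim (auto simp: g_reflect indicator_def)
  next
    have [measurable]: "poly q \<in> borel_measurable borel" for q :: "real poly"
      by (intro borel_measurable_continuous_onI continuous_intros)
    show "g p \<in> borel_measurable lborel"
      "(\<lambda>x. indicator {0<..} x * g p x + indicator {0<..} (- x) * g p' (- x)) \<in> borel_measurable lborel"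
      unfolding g_def by measurable
  qed
  also have "\<dots> = (LBINT x. indicator {0<..} x * g p x) + (LBINT x. indicator {0<..} (- x) * g p' (- x))"
    using lborel_integrable_real_affine[OF half(1)[of p'], of "-1" 0]
    by (intro Bochner_Integration.integral_add half(1)) simp
  also have "(LBINT x. indicator {0<..} (- x) * g p' (- x)) = (LBINT x. indicator {0<..} x * g p' x)"
    using lborel_integral_real_affine[of "-1" "\<lambda>x. indicator {0<..} x * g p' x" 0] by simp
  finally have "L (r p) = 0"
    by (simp add: half(2))
  moreover have "L (r p) = L ([:0, 1:] * pderiv p + smult (2 * lam + 2) p)
      - (\<Sum>k = 1..m. 2 * real k * t k * L (monom 1 (2 * k) * p))"
  proof -
    have "poly (r p) x * weight m t lam x = poly ([:0, 1:] * pderiv p + smult (2 * lam + 2) p) x * weight m t lam x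
        - (\<Sum>k = 1..m. 2 * real k * t k * (poly (monom 1 (2 * k) * p) x * weight m t lam x))" for x
      unfolding r_def
      by (simp add: poly_sum poly_monom algebra_simps sum_distrib_left sum_distrib_right)
    thus ?thesis
      unfolding weight_functional_def
      by (simp only: Bochner_Integration.integral_diff Bochner_Integration.integral_sum
            Bochner_Integration.integrable_sum integrable_mult_right integrable_poly_weight
            integral_mult_right_zero)
  qed
  ultimately show ?thesis by simp
qed

lemma semiclassical_weight: "semiclassical_polys L P m t lam"
proof
  show "L (p + q) = L p + L q" for p q
    using Bochner_Integration.integral_add[OF integrable_poly_weight integrable_poly_weight, of p q]
    by (simp add: weight_functional_def algebra_simps)
  show "L (smult a p) = a * L p" for a p
    by (simp add: weight_functional_def mult.assoc)
  show "L (P i * P j) = 0" if "i \<noteq> j" for i j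
    using ortho that
    by (auto simp: monic_orthogonal_polys_def has_bochner_integral_iff weight_functional_def)
  show "L (P n * P n) > 0" for n
    using P_monic[of n] by (intro L_square_pos) auto
qed (rule P_degree P_monic L_reflect L_pearson)+

end

theorem theorem3:
  fixes m n :: nat and t :: "nat \<Rightarrow> real" and lam x :: real
    and P :: "nat \<Rightarrow> real poly" and \<beta> :: "int \<Rightarrow> real"
  assumes "m \<ge> 1" and "t m > 0" and "lam > -1"
    and "monic_orthogonal_polys (weight m t lam) P"
    and "\<beta> = rec_coeff P"
    and "n \<ge> 1"
    and "x \<noteq> 0" and "Acoef m t \<beta> n x \<noteq> 0"
  shows "poly (pderiv (pderiv (P n))) x
    - (deriv (Vpot m t lam) x + deriv (Acoef m t \<beta> n) x / Acoef m t \<beta> n x) * poly (pderiv (P n)) x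
    + (deriv (Bcoef m t lam \<beta> n) x - (Bcoef m t lam \<beta> n x)\<^sup>2 - deriv (Vpot m t lam) x * Bcoef m t lam \<beta> n x
       + \<beta> (int n) * Acoef m t \<beta> n x * Acoef m t \<beta> (n - 1) x
       - deriv (Acoef m t \<beta> n) x * Bcoef m t lam \<beta> n x / Acoef m t \<beta> n x) * poly (P n) x = 0"
proof -
  interpret semiclassical_polys "weight_functional m t lam" P m t lam
    using assms by (intro semiclassical_weight)
  show ?thesis
    using second_order_ode assms unfolding rec_coeff_eq by simp
qed

end
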